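(* Let $m\ge n$ be positive integers, let $k$ be an integer with $1\le k\le m$, and let $G(n,m)=(V_\alpha\cup V_\beta,E)$ be a bipartite graph with $n$ left-nodes and $m$ right-nodes. Then $G(n,m)$ is a union of $k$ disjoint left-perfect matchings if and only if the following two conditions hold: (1) the degree of each left-node is exactly $k$; (2) the degree of each right-node is less than or equal to $k$.
   Context: $G(n,m)=(V_\alpha\cup V_\beta,E)$ denotes an undirected (simple) bipartite graph with left-nodes $V_\alpha=\{\alpha_1,\dots,\alpha_n\}$ and right-nodes $V_\beta=\{\beta_1,\dots,\beta_m\}$; every edge has the form $(\alpha_i,\beta_j)$. For $m\ge n$, a left-perfect matching in $G(n,m)$ is a set of $n$ edges in $E$ such that no two distinct edges of the set are incident to the same node. Two matchings $P_1,P_2$ are disjoint if $P_1\cap P_2=\varnothing$ (as sets of edges). "$G(n,m)$ is a union of $k$ disjoint left-perfect matchings" means that $E=P_1\cup\dots\cup P_k$ for some pairwise disjoint left-perfect matchings $P_1,\dots,P_k$. *)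

theory Defs
  imports Main "HOL-Library.Disjoint_Sets"
begin

(* A simple bipartite graph is given by its finite sets A of left-nodes and B of right-nodes
   and its set of edges. Every undirected edge joins a left-node a to a right-node b and is
   written as the pair (a, b), left-node first. The two sides of a pair are kept apart
   even if 'a = 'b, so A and B act as disjoint node sets: a node of the graph is
   Inl a or Inr b in the sum type. *)

definition bipartite_graph :: "'a set \<Rightarrow> 'b set \<Rightarrow> ('a \<times> 'b) set \<Rightarrow> bool" where
  "bipartite_graph A B E \<longleftrightarrow> finite A \<and> finite B \<and> E \<subseteq> A \<times> B"

definition incident :: "'a \<times> 'b \<Rightarrow> 'a + 'b \<Rightarrow> bool" where
  "incident e v \<longleftrightarrow> v = Inl (fst e) \<or> v = Inr (snd e)"

definition degree :: "('a \<times> 'b) set \<Rightarrow> 'a + 'b \<Rightarrow> nat" where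
  "degree E v = card {e \<in> E. incident e v}"

definition left_perfect_matching ::
  "'a set \<Rightarrow> ('a \<times> 'b) set \<Rightarrow> ('a \<times> 'b) set \<Rightarrow> bool" where
  "left_perfect_matching A E P \<longleftrightarrow>
     P \<subseteq> E \<and> card P = card A \<and>
     (\<forall>e\<in>P. \<forall>f\<in>P. e \<noteq> f \<longrightarrow> (\<nexists>v. incident e v \<and> incident f v))"

definition union_of_disjoint_left_perfect_matchings ::
  "nat \<Rightarrow> 'a set \<Rightarrow> ('a \<times> 'b) set \<Rightarrow> bool" where
  "union_of_disjoint_left_perfect_matchings k A E \<longleftrightarrow>
     (\<exists>P :: nat \<Rightarrow> ('a \<times> 'b) set.
        (\<forall>i\<in>{1..k}. left_perfect_matching A E (P i)) \<and>
        disjoint_family_on P {1..k} \<and>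
        E = (\<Union>i\<in>{1..k}. P i))"

end

theory Submission
  imports Defs "HOL-Combinatorics.Transposition"
begin

text \<open>
  A decomposition into \<open>k\<close> matchings is a proper edge colouring with \<open>k\<close> colours whose colour
  classes are the matchings. In a left-perfect matching every left-node lies on exactly one edge
  and every right-node on at most one, so adding up the degrees over the \<open>k\<close> matchings gives the
  two degree conditions.

  Conversely, the degree conditions say that the graph has maximum degree at most \<open>k\<close>, and
  Koenig's edge colouring theorem (\<open>bipartite_edge_coloring\<close>) provides a proper colouring with
  \<open>k\<close> colours. The \<open>k\<close> edges at a left-node get distinct colours out of \<open>k\<close>, so every colour
  occurs at every left-node: each colour class is left-perfect.

  Koenig's theorem is proved by induction on the edges. For a new edge \<open>(a, b)\<close>, some colour \<open>p\<close>
  is unused at \<open>a\<close> and some colour \<open>q\<close> is unused at \<open>b\<close>. Exchanging \<open>p\<close> and \<open>q\<close> along the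
  alternating chain that starts in \<open>a\<close> makes \<open>q\<close> unused at \<open>a\<close>. Because the graph is bipartite,
  that chain enters right-nodes through edges of colour \<open>q\<close> only, hence never meets \<open>b\<close>, and the
  new edge can be given the colour \<open>q\<close> (\<open>exchange_colors_along_chain\<close>).
\<close>

section \<open>Proper edge colourings of bipartite graphs\<close>

definition proper_edge_coloring :: "nat \<Rightarrow> ('a \<times> 'b) set \<Rightarrow> ('a \<times> 'b \<Rightarrow> nat) \<Rightarrow> bool" where
  "proper_edge_coloring k E c \<longleftrightarrow>
     c ` E \<subseteq> {1..k} \<and> (\<forall>v. inj_on c {e \<in> E. incident e v})"

definition unused_color :: "('a \<times> 'b) set \<Rightarrow> ('a \<times> 'b \<Rightarrow> nat) \<Rightarrow> 'a + 'b \<Rightarrow> nat \<Rightarrow> bool" where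
  "unused_color E c v p \<longleftrightarrow> (\<forall>e\<in>E. incident e v \<longrightarrow> c e \<noteq> p)"

lemma incident_simps [simp]:
  "incident e (Inl a) \<longleftrightarrow> fst e = a"
  "incident e (Inr b) \<longleftrightarrow> snd e = b"
  by (auto simp: incident_def)

lemma proper_edge_coloringD:
  assumes "proper_edge_coloring k E c" "e \<in> E" "f \<in> E" "incident e v" "incident f v" "c e = c f"
  shows "e = f"
  using assms unfolding proper_edge_coloring_def inj_on_def by blast

lemma ex_unused_color:
  assumes "finite E" "degree E v < k"
  shows "\<exists>p\<in>{1..k}. unused_color E c v p"
proof -
  have "card (c ` {e \<in> E. incident e v}) < card {1..k}"
    using card_image_le[of "{e \<in> E. incident e v}" c] assms by (simp add: degree_def)
  then have "\<not> {1..k} \<subseteq> c ` {e \<in> E. incident e v}"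
    using card_mono[of "c ` {e \<in> E. incident e v}" "{1..k}"] assms(1) by auto
  then obtain p where "p \<in> {1..k}" "p \<notin> c ` {e \<in> E. incident e v}"
    by blast
  moreover from this have "unused_color E c v p"
    by (auto simp: unused_color_def)
  ultimately show ?thesis
    by blast
qed

text \<open>
  The chain is described by its node sets \<open>L\<close> and \<open>R\<close> instead of as a path: \<open>L\<close> contains the
  left-nodes that can be reached from \<open>a\<close> by following an edge of colour \<open>q\<close> to the right and an
  edge of colour \<open>p\<close> back to the left, again and again, and \<open>R\<close> contains the right-nodes passed on
  the way. No edge of colour \<open>p\<close> or \<open>q\<close> leaves \<open>L \<union> R\<close>: such edges occur at most once per node and
  colour, and \<open>a\<close>, the only node of \<open>L\<close> not entered through an edge of colour \<open>p\<close>, has no such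
  edge at all. So at every node either all edges of these colours are recoloured or none.
\<close>

lemma exchange_colors_along_chain:
  assumes c: "proper_edge_coloring k E c"
    and pq: "p \<in> {1..k}" "q \<in> {1..k}"
    and a: "unused_color E c (Inl a) p"
    and b: "unused_color E c (Inr b) q"
  shows "\<exists>c'. proper_edge_coloring k E c' \<and>
           unused_color E c' (Inl a) q \<and> unused_color E c' (Inr b) q"
proof -
  define step where
    "step = {(x, y). \<exists>r. (x, r) \<in> E \<and> c (x, r) = q \<and> (y, r) \<in> E \<and> c (y, r) = p}"
  define L where "L = step\<^sup>* `` {a}"
  define R where "R = {r. \<exists>x\<in>L. (x, r) \<in> E \<and> c (x, r) = q}"
  define c' where "c' e = (if fst e \<in> L then transpose p q (c e) else c e)" for e
  have aL: "a \<in> L"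
    by (simp add: L_def)
  have L_closed: "y \<in> L" if "x \<in> L" "(x, r) \<in> E" "c (x, r) = q" "(y, r) \<in> E" "c (y, r) = p" for x y r
  proof -
    have "(x, y) \<in> step" using that by (auto simp: step_def)
    with \<open>x \<in> L\<close> show ?thesis unfolding L_def by (auto intro: rtrancl_into_rtrancl)
  qed
  have L_cases: "x = a \<or> (\<exists>r\<in>R. (x, r) \<in> E \<and> c (x, r) = p)" if "x \<in> L" for x
  proof -
    from that have "(a, x) \<in> step\<^sup>*" by (simp add: L_def)
    then show ?thesis
      by (cases rule: rtranclE) (auto simp: step_def R_def L_def)
  qed
  have same_side: "x \<in> L \<longleftrightarrow> r \<in> R" if e: "(x, r) \<in> E" and col: "c (x, r) = p \<or> c (x, r) = q" for x r
  proof
    assume x: "x \<in> L"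
    show "r \<in> R"
    proof (cases "c (x, r) = q")
      case True
      with x e show ?thesis by (auto simp: R_def)
    next
      case False
      with col have p: "c (x, r) = p" by simp
      with a e have "x \<noteq> a" by (auto simp: unused_color_def)
      with L_cases[OF x] obtain s where s: "s \<in> R" "(x, s) \<in> E" "c (x, s) = p" by auto
      have "(x, r) = (x, s)"
        by (rule proper_edge_coloringD[OF c e s(2), of "Inl x"]) (simp_all add: p s)
      with s show ?thesis by simp
    qed
  next
    assume "r \<in> R"
    then obtain y where y: "y \<in> L" "(y, r) \<in> E" "c (y, r) = q" by (auto simp: R_def)
    show "x \<in> L"
    proof (cases "c (x, r) = q")
      case True
      have "(x, r) = (y, r)"
        by (rule proper_edge_coloringD[OF c e y(2), of "Inr r"]) (simp_all add: True y)
      with y show ?thesis by simp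
    next
      case False
      with col L_closed[OF y e] show ?thesis by simp
    qed
  qed
  have c'_R: "c' e = (if snd e \<in> R then transpose p q (c e) else c e)" if "e \<in> E" for e
    using same_side[of "fst e" "snd e"] that by (cases e) (auto simp: c'_def transpose_def)
  have inj: "inj_on c' {e \<in> E. incident e v}" for v
  proof -
    have "(\<forall>e\<in>{e \<in> E. incident e v}. c' e = (transpose p q \<circ> c) e) \<or>
          (\<forall>e\<in>{e \<in> E. incident e v}. c' e = c e)"
    proof (cases v)
      case (Inl x)
      then show ?thesis by (cases "x \<in> L") (auto simp: c'_def)
    next
      case (Inr r)
      then show ?thesis by (cases "r \<in> R") (auto simp: c'_R)
    qed
    moreover have "inj_on c {e \<in> E. incident e v}"
      using c by (simp add: proper_edge_coloring_def)
    moreover from this have "inj_on (transpose p q \<circ> c) {e \<in> E. incident e v}"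
      by (rule comp_inj_on) (rule inj_on_transpose)
    ultimately show ?thesis
      by (metis (no_types, lifting) inj_on_cong)
  qed
  have "c' ` E \<subseteq> {1..k}"
    using c pq by (auto simp: proper_edge_coloring_def c'_def transpose_def)
  with inj have "proper_edge_coloring k E c'"
    by (simp add: proper_edge_coloring_def)
  moreover have "unused_color E c' (Inl a) q"
    using a aL by (auto simp: unused_color_def c'_def transpose_eq_iff)
  moreover have "unused_color E c' (Inr b) q"
  proof -
    have "b \<notin> R"
      using b by (auto simp: R_def unused_color_def)
    with b show ?thesis
      by (auto simp: unused_color_def c'_R)
  qed
  ultimately show ?thesis by blast
qed

lemma degree_mono: "finite F \<Longrightarrow> E \<subseteq> F \<Longrightarrow> degree E v \<le> degree F v"
  unfolding degree_def by (rule card_mono) auto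

lemma degree_insert:
  assumes "finite E" "e \<notin> E" "incident e v"
  shows "degree (insert e E) v = Suc (degree E v)"
proof -
  have "{f \<in> insert e E. incident f v} = insert e {f \<in> E. incident f v}"
    using assms by auto
  then show ?thesis
    using assms by (simp add: degree_def)
qed

lemma proper_edge_coloring_insert:
  assumes c: "proper_edge_coloring k E c" and e: "e \<notin> E" and q: "q \<in> {1..k}"
    and unused: "\<And>v. incident e v \<Longrightarrow> unused_color E c v q"
  shows "proper_edge_coloring k (insert e E) (c(e := q))"
  unfolding proper_edge_coloring_def
proof (intro conjI allI)
  show "(c(e := q)) ` insert e E \<subseteq> {1..k}"
    using c q by (auto simp: proper_edge_coloring_def)
next
  fix v
  show "inj_on (c(e := q)) {f \<in> insert e E. incident f v}"
  proof (rule inj_onI)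
    fix f g
    assume "f \<in> {f \<in> insert e E. incident f v}" "g \<in> {f \<in> insert e E. incident f v}"
      and "(c(e := q)) f = (c(e := q)) g"
    then show "f = g"
      using unused[of v] e proper_edge_coloringD[OF c, of f g v]
      by (auto simp: unused_color_def split: if_splits)
  qed
qed

text \<open>
  Koenig's edge colouring theorem. The graph is bipartite by its type: every edge is a pair of a
  left-node and a right-node.
\<close>

theorem bipartite_edge_coloring:
  fixes E :: "('a \<times> 'b) set"
  assumes "finite E" "\<And>v. degree E v \<le> k"
  shows "\<exists>c. proper_edge_coloring k E c"
  using assms
proof (induction E rule: finite_induct)
  case empty
  show ?case by (simp add: proper_edge_coloring_def)
next
  case (insert e E)
  obtain a b where e: "e = (a, b)" by (cases e)
  have "degree E v \<le> k" for v
    using degree_mono[of "insert e E" E v] insert.hyps(1) insert.prems[of v]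
    by (simp add: subset_insertI)
  with insert.IH obtain c where c: "proper_edge_coloring k E c" by blast
  have deg: "degree E v < k" if "incident e v" for v
    using degree_insert[OF insert.hyps that] insert.prems[of v] by simp
  have ends: "incident e (Inl a)" "incident e (Inr b)"
    by (simp_all add: e)
  obtain p where p: "p \<in> {1..k}" "unused_color E c (Inl a) p"
    using ex_unused_color[OF insert.hyps(1) deg[OF ends(1)]] by blast
  obtain q where q: "q \<in> {1..k}" "unused_color E c (Inr b) q"
    using ex_unused_color[OF insert.hyps(1) deg[OF ends(2)]] by blast
  obtain c' where c': "proper_edge_coloring k E c'"
      "unused_color E c' (Inl a) q" "unused_color E c' (Inr b) q"
    using exchange_colors_along_chain[OF c p(1) q(1) p(2) q(2)] by blast
  have "unused_color E c' v q" if "incident e v" for v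
    using that c'(2,3) e by (auto simp: incident_def)
  with proper_edge_coloring_insert[OF c'(1) insert.hyps(2) q(1)] show ?case
    by blast
qed

section \<open>Matchings and degrees\<close>

lemma degree_Union_disjoint:
  assumes "finite I" "\<And>i. i \<in> I \<Longrightarrow> finite (P i)" "disjoint_family_on P I"
  shows "degree (\<Union>i\<in>I. P i) v = (\<Sum>i\<in>I. degree (P i) v)"
proof -
  have "{e \<in> (\<Union>i\<in>I. P i). incident e v} = (\<Union>i\<in>I. {e \<in> P i. incident e v})"
    by auto
  moreover have "card (\<Union>i\<in>I. {e \<in> P i. incident e v}) = (\<Sum>i\<in>I. card {e \<in> P i. incident e v})"
    using assms by (intro card_UN_disjoint) (auto simp: disjoint_family_on_def)
  ultimately show ?thesis
    by (simp add: degree_def)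
qed

lemma left_perfect_matching_degree_le_1:
  assumes "left_perfect_matching A E P"
  shows "degree P v \<le> 1"
proof -
  have "e = f" if "e \<in> P" "f \<in> P" "incident e v" "incident f v" for e f
    using assms that unfolding left_perfect_matching_def by blast
  then have "\<exists>e. {e \<in> P. incident e v} \<subseteq> {e}"
    by blast
  then obtain e where "{e \<in> P. incident e v} \<subseteq> {e}" ..
  then have "card {e \<in> P. incident e v} \<le> card {e}"
    by (intro card_mono) auto
  then show ?thesis
    by (simp add: degree_def)
qed

text \<open>
  Counting is what makes a matching with as many edges as there are left-nodes cover all of them:
  its edges have distinct left ends.
\<close>

lemma left_perfect_matching_degree_left:
  assumes G: "bipartite_graph A B E" and P: "left_perfect_matching A E P" and a: "a \<in> A"
  shows "degree P (Inl a) = 1"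
proof -
  have fin: "finite A" "finite P"
    using G P finite_subset[of P "A \<times> B"]
    by (auto simp: bipartite_graph_def left_perfect_matching_def)
  have "fst e \<noteq> fst f" if "e \<in> P" "f \<in> P" "e \<noteq> f" for e f
  proof
    assume "fst e = fst f"
    then have "incident e (Inl (fst e))" "incident f (Inl (fst e))" by auto
    with P that show False unfolding left_perfect_matching_def by blast
  qed
  then have "inj_on fst P"
    by (meson inj_onI)
  then have "card (fst ` P) = card A"
    using P by (simp add: card_image left_perfect_matching_def)
  moreover have "fst ` P \<subseteq> A"
    using G P by (auto simp: bipartite_graph_def left_perfect_matching_def)
  ultimately have "fst ` P = A"
    using fin(1) by (intro card_subset_eq)
  with a have "{e \<in> P. incident e (Inl a)} \<noteq> {}"
    by auto
  with fin have "degree P (Inl a) \<noteq> 0"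
    by (simp add: degree_def)
  with left_perfect_matching_degree_le_1[OF P, of "Inl a"] show ?thesis
    by simp
qed

lemma degree_outside:
  assumes "bipartite_graph A B E" "v \<notin> Inl ` A \<union> Inr ` B"
  shows "degree E v = 0"
proof -
  have "{e \<in> E. incident e v} = {}"
    using assms by (cases v) (auto simp: bipartite_graph_def)
  then show ?thesis
    by (simp only: degree_def card.empty)
qed

lemma color_class_left_perfect_matching:
  assumes G: "bipartite_graph A B E" and c: "proper_edge_coloring k E c"
    and deg: "\<And>a. a \<in> A \<Longrightarrow> degree E (Inl a) = k" and i: "i \<in> {1..k}"
  shows "left_perfect_matching A E {e \<in> E. c e = i}"
proof -
  let ?P = "{e \<in> E. c e = i}"
  have "inj_on fst ?P"
  proof (rule inj_onI)
    fix e f assume "e \<in> ?P" "f \<in> ?P" "fst e = fst f"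
    then show "e = f"
      using proper_edge_coloringD[OF c, of e f "Inl (fst e)"] by simp
  qed
  moreover have "fst ` ?P = A"
  proof
    show "fst ` ?P \<subseteq> A"
      using G by (auto simp: bipartite_graph_def)
    show "A \<subseteq> fst ` ?P"
    proof
      fix a assume "a \<in> A"
      let ?S = "{e \<in> E. incident e (Inl a)}"
      have "inj_on c ?S" "c ` ?S \<subseteq> {1..k}"
        using c unfolding proper_edge_coloring_def by blast+
      moreover from this have "card (c ` ?S) = card {1..k}"
        using deg[OF \<open>a \<in> A\<close>] by (simp add: card_image degree_def)
      ultimately have "c ` ?S = {1..k}"
        by (intro card_subset_eq) auto
      with i have "i \<in> c ` ?S"
        by (simp only:)
      then show "a \<in> fst ` ?P"
        by auto
    qed
  qed
  ultimately have "card ?P = card A"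
    using card_image[of fst ?P] by simp
  moreover have "\<nexists>v. incident e v \<and> incident f v" if "e \<in> ?P" "f \<in> ?P" "e \<noteq> f" for e f
    using that proper_edge_coloringD[OF c, of e f] by auto
  ultimately show ?thesis
    unfolding left_perfect_matching_def by blast
qed

section \<open>Decomposition into left-perfect matchings\<close>

theorem theorem1:
  fixes n m k :: nat
    and A :: "'a set" and B :: "'b set" and E :: "('a \<times> 'b) set"
  assumes "0 < n" and "n \<le> m"
    and "1 \<le> k" and "k \<le> m"
    and "bipartite_graph A B E"
    and "card A = n" and "card B = m"
  shows "union_of_disjoint_left_perfect_matchings k A E \<longleftrightarrow>
    (\<forall>a\<in>A. degree E (Inl a) = k) \<and> (\<forall>b\<in>B. degree E (Inr b) \<le> k)"
proof
  note G = \<open>bipartite_graph A B E\<close>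
  have finE: "finite E"
    using G finite_subset[of E "A \<times> B"] by (auto simp: bipartite_graph_def)
  {
    assume "union_of_disjoint_left_perfect_matchings k A E"
    then obtain P where P: "\<And>i. i \<in> {1..k} \<Longrightarrow> left_perfect_matching A E (P i)"
        and disj: "disjoint_family_on P {1..k}" and E: "E = (\<Union>i\<in>{1..k}. P i)"
      unfolding union_of_disjoint_left_perfect_matchings_def by blast
    have "finite (P i)" if "i \<in> {1..k}" for i
      using P[OF that] finE finite_subset by (auto simp: left_perfect_matching_def)
    then have deg: "degree E v = (\<Sum>i\<in>{1..k}. degree (P i) v)" for v
      unfolding E using disj by (intro degree_Union_disjoint) auto
    have "degree E (Inl a) = k" if "a \<in> A" for a
      using left_perfect_matching_degree_left[OF G P that] by (simp add: deg)
    moreover have "degree E (Inr b) \<le> k" for b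
      using sum_mono[of "{1..k}" "\<lambda>i. degree (P i) (Inr b)" "\<lambda>_. 1"]
        left_perfect_matching_degree_le_1[OF P] by (simp add: deg)
    ultimately show "(\<forall>a\<in>A. degree E (Inl a) = k) \<and> (\<forall>b\<in>B. degree E (Inr b) \<le> k)"
      by blast
  next
    assume deg: "(\<forall>a\<in>A. degree E (Inl a) = k) \<and> (\<forall>b\<in>B. degree E (Inr b) \<le> k)"
    have "degree E v \<le> k" for v
      using deg degree_outside[OF G, of v] by (cases "v \<in> Inl ` A \<union> Inr ` B") auto
    with bipartite_edge_coloring[OF finE] obtain c where c: "proper_edge_coloring k E c"
      by blast
    let ?P = "\<lambda>i. {e \<in> E. c e = i}"
    have "\<forall>i\<in>{1..k}. left_perfect_matching A E (?P i)"
      using color_class_left_perfect_matching[OF G c] deg by blast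
    moreover have "disjoint_family_on ?P {1..k}"
      by (auto simp: disjoint_family_on_def)
    moreover have "E = (\<Union>i\<in>{1..k}. ?P i)"
      using c by (auto simp: proper_edge_coloring_def)
    ultimately show "union_of_disjoint_left_perfect_matchings k A E"
      unfolding union_of_disjoint_left_perfect_matchings_def by (intro exI[of _ ?P]) blast
  }
qed

end
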